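(* Let $n\ge 1$ be an integer. The extended Hamming graph $EH(n,2^n)$ is a Cayley graph, i.e., there exist a finite group $G$ and a subset $S\subseteq G\setminus\{1\}$ with $S=S^{-1}$ such that $EH(n,2^n)$ is isomorphic to $\operatorname{Cay}(G,S)$.
   Context: Let $\Omega=\{0,1,\dots,2^n-1\}$. The Hamming graph $H(n,2^n)$ has vertex set $\Omega^n$, two $n$-tuples being adjacent if and only if they differ in exactly one coordinate. For $u=(u_1,\dots,u_n)\in\Omega^n$ define its complement $u^c=(2^n-1-u_1,\dots,2^n-1-u_n)$. The extended Hamming graph $EH(n,2^n)$ has vertex set $\Omega^n$ and edge set $E(H(n,2^n))\cup\{\{u,u^c\} : u\in\Omega^n,\ u\neq u^c\}$. For a finite group $G$ with identity $1$ and an inverse-closed subset $S\subseteq G\setminus\{1\}$, the Cayley graph $\operatorname{Cay}(G,S)$ has vertex set $G$ and edges $\{g,h\}$ with $g^{-1}h\in S$. *)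

theory Defs
  imports
    "HOL-Algebra.Coset"
    "Graph_Theory.Pair_Digraph"
    "Graph_Theory.Digraph_Isomorphism"
begin

text \<open>
  Following the convention of \<^theory>\<open>Graph_Theory.Digraph\<close>, a simple graph is a loop-free
  symmetric digraph without parallel arcs: the edge \<open>{u, v}\<close> is represented by the two arcs
  \<open>(u, v)\<close> and \<open>(v, u)\<close>.  The lemmas \<open>pair_graph_*\<close> below
  confirm that the graphs defined here are finite simple graphs in this sense, and
  \<open>digraph_iso_with_proj_iff\<close> that \<^const>\<open>digraph_iso\<close> is
  ordinary graph isomorphism for them.

  An existentially quantified finite group may be taken to live on any fixed infinite carrier
  type, since every finite group is isomorphic to one on such a type.
\<close>

definition tuples :: "nat \<Rightarrow> nat \<Rightarrow> nat list set" where
  "tuples d q = {u. length u = d \<and> set u \<subseteq> {0..<q}}"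

definition hamming_graph :: "nat \<Rightarrow> nat \<Rightarrow> nat list pair_pre_digraph" where
  "hamming_graph d q =
     \<lparr>pverts = tuples d q,
      parcs = {(u, v). u \<in> tuples d q \<and> v \<in> tuples d q \<and> (\<exists>!i. i < d \<and> u ! i \<noteq> v ! i)}\<rparr>"

text \<open>The truncated subtraction is harmless on entries below \<open>q\<close>.\<close>

definition tuple_compl :: "nat \<Rightarrow> nat list \<Rightarrow> nat list" where
  "tuple_compl q u = map (\<lambda>x. q - 1 - x) u"

definition extended_hamming_graph :: "nat \<Rightarrow> nat \<Rightarrow> nat list pair_pre_digraph" where
  "extended_hamming_graph d q =
     \<lparr>pverts = tuples d q,
      parcs = parcs (hamming_graph d q) \<union>
        {(u, tuple_compl q u) | u. u \<in> tuples d q \<and> u \<noteq> tuple_compl q u}\<rparr>"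

definition cayley_graph :: "('a, 'b) monoid_scheme \<Rightarrow> 'a set \<Rightarrow> 'a pair_pre_digraph" where
  "cayley_graph G S =
     \<lparr>pverts = carrier G,
      parcs = {(g, h). g \<in> carrier G \<and> h \<in> carrier G \<and> inv\<^bsub>G\<^esub> g \<otimes>\<^bsub>G\<^esub> h \<in> S}\<rparr>"

lemma finite_tuples: "finite (tuples d q)"
  unfolding tuples_def using finite_lists_length_eq[of "{0..<q}" d]
  by (simp add: conj_commute)

lemma tuple_compl_in_tuples: "u \<in> tuples d q \<Longrightarrow> tuple_compl q u \<in> tuples d q"
  by (fastforce simp: tuples_def tuple_compl_def)

lemma tuple_compl_tuple_compl: "u \<in> tuples d q \<Longrightarrow> tuple_compl q (tuple_compl q u) = u"
  by (force simp: tuples_def tuple_compl_def o_def intro: map_idI)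

lemma pair_graphI:
  assumes "finite V" and "E \<subseteq> V \<times> V" and "sym E" and "\<And>u. (u, u) \<notin> E"
  shows "pair_graph \<lparr>pverts = V, parcs = E\<rparr>"
proof -
  have "finite E"
    using assms(1,2) by (meson finite_SigmaI finite_subset)
  moreover have "symmetric (with_proj \<lparr>pverts = V, parcs = E\<rparr>)"
    using assms(3) by (simp add: symmetric_def arcs_ends_conv)
  ultimately show ?thesis
    using assms by unfold_locales auto
qed

lemma pair_graph_hamming_graph: "pair_graph (hamming_graph d q)"
  unfolding hamming_graph_def
  by (intro pair_graphI finite_tuples) (auto simp: sym_def eq_commute[where 'a = nat])

lemma pair_graph_extended_hamming_graph: "pair_graph (extended_hamming_graph d q)"
  unfolding extended_hamming_graph_def
proof (intro pair_graphI finite_tuples)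
  interpret pair_graph "hamming_graph d q" by (rule pair_graph_hamming_graph)
  let ?C = "{(u, tuple_compl q u) | u. u \<in> tuples d q \<and> u \<noteq> tuple_compl q u}"
  show "parcs (hamming_graph d q) \<union> ?C \<subseteq> tuples d q \<times> tuples d q"
    by (auto simp: hamming_graph_def tuple_compl_in_tuples)
  have "sym (parcs (hamming_graph d q))"
    by (auto simp: hamming_graph_def sym_def eq_commute[where 'a = nat])
  moreover have "sym ?C"
    by (rule symI) (auto simp: tuple_compl_in_tuples tuple_compl_tuple_compl)
  ultimately show "sym (parcs (hamming_graph d q) \<union> ?C)"
    by (rule sym_Un)
  show "(u, u) \<notin> parcs (hamming_graph d q) \<union> ?C" for u
    by (auto simp: hamming_graph_def)
qed

lemma pair_graph_cayley_graph:
  assumes "group G" and "finite (carrier G)"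
    and "S \<subseteq> carrier G - {\<one>\<^bsub>G\<^esub>}" and "S = set_inv\<^bsub>G\<^esub> S"
  shows "pair_graph (cayley_graph G S)"
  unfolding cayley_graph_def
proof (intro pair_graphI assms(2))
  interpret group G by fact
  let ?E = "{(g, h). g \<in> carrier G \<and> h \<in> carrier G \<and> inv\<^bsub>G\<^esub> g \<otimes>\<^bsub>G\<^esub> h \<in> S}"
  show "?E \<subseteq> carrier G \<times> carrier G" by auto
  have "inv\<^bsub>G\<^esub> s \<in> S" if "s \<in> S" for s
    using that assms(4) by (auto simp: SET_INV_def)
  then have "inv\<^bsub>G\<^esub> h \<otimes>\<^bsub>G\<^esub> g \<in> S"
    if "g \<in> carrier G" "h \<in> carrier G" "inv\<^bsub>G\<^esub> g \<otimes>\<^bsub>G\<^esub> h \<in> S" for g h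
    using that by (metis inv_closed inv_inv inv_mult_group)
  then show "sym ?E" by (auto simp: sym_def)
  show "(u, u) \<notin> ?E" for u using assms(3) by auto
qed

lemma digraph_iso_with_proj_iff:
  assumes "pair_graph X" and "pair_graph Y"
  shows "digraph_iso (with_proj X) (with_proj Y) \<longleftrightarrow>
    (\<exists>f. bij_betw f (pverts X) (pverts Y) \<and>
      (\<forall>u\<in>pverts X. \<forall>v\<in>pverts X. (u, v) \<in> parcs X \<longleftrightarrow> (f u, f v) \<in> parcs Y))"
    (is "?L \<longleftrightarrow> ?R")
proof
  interpret X: pair_graph X by fact
  interpret Y: pair_graph Y by fact
  {
    assume ?L
    then obtain h where h: "pre_digraph.digraph_isomorphism (with_proj X) h"
      and Y: "with_proj Y = app_iso h (with_proj X)"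
      by (auto simp: digraph_iso_def)
    let ?f = "iso_verts h"
    have V: "pverts Y = ?f ` pverts X" and A: "parcs Y = iso_arcs h ` parcs X"
      and T: "iso_tail h = fst" and H: "iso_head h = snd"
      using Y by (auto simp: with_proj_def app_iso_def)
    have inj: "inj_on ?f (pverts X)"
      using h by (simp add: pre_digraph.digraph_isomorphism_def)
    have "iso_arcs h e = (?f (fst e), ?f (snd e))" if "e \<in> parcs X" for e
      using h that T H
      by (auto simp: pre_digraph.digraph_isomorphism_def prod_eq_iff)
    then have A': "parcs Y = (\<lambda>e. (?f (fst e), ?f (snd e))) ` parcs X"
      using A by simp
    have "(u, v) \<in> parcs X \<longleftrightarrow> (?f u, ?f v) \<in> parcs Y"
      if "u \<in> pverts X" "v \<in> pverts X" for u v
    proof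
      assume "(?f u, ?f v) \<in> parcs Y"
      then obtain u' v' where e: "(u', v') \<in> parcs X" "?f u = ?f u'" "?f v = ?f v'"
        by (auto simp: A')
      then have "u = u'" "v = v'"
        using inj that X.in_arcsD1[OF e(1)] X.in_arcsD2[OF e(1)] by (auto dest: inj_onD)
      with e(1) show "(u, v) \<in> parcs X" by simp
    qed (force simp: A')
    with inj V show ?R by (auto simp: bij_betw_def)
  }
  {
    assume ?R
    then obtain f where f: "bij_betw f (pverts X) (pverts Y)"
      and E: "\<And>u v. u \<in> pverts X \<Longrightarrow> v \<in> pverts X \<Longrightarrow> (u, v) \<in> parcs X \<longleftrightarrow> (f u, f v) \<in> parcs Y"
      by auto
    let ?h = "\<lparr>iso_verts = f, iso_arcs = map_prod f f, iso_head = snd, iso_tail = fst\<rparr>"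
    have inj: "inj_on f (pverts X)" and V: "pverts Y = f ` pverts X"
      using f by (auto simp: bij_betw_def)
    have "parcs X \<subseteq> pverts X \<times> pverts X"
      using X.in_arcsD1 X.in_arcsD2 by auto
    then have inj': "inj_on (map_prod f f) (parcs X)"
      using map_prod_inj_on[OF inj inj] inj_on_subset by blast
    have "pre_digraph.digraph_isomorphism (with_proj X) ?h"
      using inj inj' X.wf_digraph by (auto simp: pre_digraph.digraph_isomorphism_def)
    moreover have "parcs Y = map_prod f f ` parcs X"
    proof (intro equalityI subsetI)
      fix e assume e: "e \<in> parcs Y"
      obtain x y where xy: "e = (x, y)" by fastforce
      with e have "x \<in> f ` pverts X" "y \<in> f ` pverts X"
        using Y.in_arcsD1 Y.in_arcsD2 V by blast+
      then obtain u v where uv: "u \<in> pverts X" "v \<in> pverts X" "x = f u" "y = f v"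
        by blast
      with e xy E[OF uv(1,2)] have "(u, v) \<in> parcs X" by simp
      then have "map_prod f f (u, v) \<in> map_prod f f ` parcs X" by (rule imageI)
      then show "e \<in> map_prod f f ` parcs X" using xy uv by simp
    next
      fix e assume "e \<in> map_prod f f ` parcs X"
      then obtain u v where uv: "(u, v) \<in> parcs X" "e = (f u, f v)" by auto
      then show "e \<in> parcs Y"
        using E[OF X.in_arcsD1[OF uv(1)] X.in_arcsD2[OF uv(1)]] by simp
    qed
    then have "with_proj Y = app_iso ?h (with_proj X)"
      using V by (simp add: with_proj_def app_iso_def)
    ultimately show ?L by (auto simp: digraph_iso_def)
  }
qed

end

theory Submission
  imports Defs
begin

unbundle bit_operations_syntax

text \<open>
  Under binary expansion \<open>{0..<2 ^ k}\<close> is an elementary abelian 2-group for bitwise XOR, and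
  complementation is translation by the all-ones word \<open>2 ^ k - 1\<close>. So in the group of
  tuples with componentwise XOR, the Hamming arcs are the differences with a single nonzero entry
  and the complement arcs are the differences equal to the constant tuple \<open>2 ^ k - 1\<close>.
\<close>

text \<open>Being below \<open>2 ^ k\<close> means being fixed by \<open>take_bit k\<close>, and
  \<open>take_bit\<close> distributes over XOR.\<close>

lemma xor_nat_less_two_power:
  fixes x y :: nat
  assumes "x < 2 ^ k" and "y < 2 ^ k"
  shows "x XOR y < 2 ^ k"
  using assms by (simp add: take_bit_xor flip: take_bit_nat_eq_self_iff)

text \<open>The words \<open>x\<close> and \<open>x XOR mask k\<close> have disjoint bits that
  together fill \<open>mask k\<close>. Hence they add without carries, their sum is
  \<open>mask k\<close>, and XOR with the mask becomes a subtraction.\<close>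

lemma xor_two_power_minus_1_nat:
  fixes x :: nat
  assumes "x < 2 ^ k"
  shows "x XOR (2 ^ k - 1) = 2 ^ k - 1 - x"
proof -
  have bit: "i < k" if "bit x i" for i
    using that assms bit_take_bit_iff[of k x i] by (simp flip: take_bit_nat_eq_self_iff)
  have "x AND (x XOR mask k) = 0"
    by (rule bit_eqI) (auto simp: bit_simps dest: bit)
  moreover have "x OR (x XOR mask k) = mask k"
    by (rule bit_eqI) (auto simp: bit_simps dest: bit)
  ultimately have "x + (x XOR mask k) = mask k"
    by (simp add: disjunctive_add_eq_or)
  then show ?thesis
    by (simp add: mask_eq_exp_minus_1)
qed

text \<open>XOR with \<open>x\<close> is an involution, so \<open>x\<close> can be moved across an
  equation.\<close>

lemma xor_eq_iff_nat: "x XOR y = z \<longleftrightarrow> y = x XOR z" for x y z :: nat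
  by (auto simp flip: xor.assoc)

lemma xor_eq_0_iff_nat: "x XOR y = 0 \<longleftrightarrow> x = y" for x y :: nat
  by (auto simp: xor_eq_iff_nat)

definition xor_tuple :: "nat list \<Rightarrow> nat list \<Rightarrow> nat list" where
  "xor_tuple = map2 (XOR)"

definition xor_tuple_group :: "nat \<Rightarrow> nat \<Rightarrow> nat list monoid" where
  "xor_tuple_group d k =
     \<lparr>carrier = tuples d (2 ^ k), monoid.mult = xor_tuple, one = replicate d 0\<rparr>"

lemma xor_tuple_group_simps [simp]:
  "carrier (xor_tuple_group d k) = tuples d (2 ^ k)"
  "u \<otimes>\<^bsub>xor_tuple_group d k\<^esub> v = xor_tuple u v"
  "\<one>\<^bsub>xor_tuple_group d k\<^esub> = replicate d 0"
  by (simp_all add: xor_tuple_group_def)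

lemma tuples_iff_nth: "u \<in> tuples d q \<longleftrightarrow> length u = d \<and> (\<forall>i<d. u ! i < q)"
  by (force simp: tuples_def in_set_conv_nth)

lemma length_xor_tuple [simp]: "length (xor_tuple u v) = min (length u) (length v)"
  by (simp add: xor_tuple_def)

lemma nth_xor_tuple [simp]:
  "i < length u \<Longrightarrow> i < length v \<Longrightarrow> xor_tuple u v ! i = u ! i XOR v ! i"
  by (simp add: xor_tuple_def)

lemma xor_tuple_self: "length u = d \<Longrightarrow> xor_tuple u u = replicate d 0"
  by (simp add: list_eq_iff_nth_eq)

lemma group_xor_tuple_group: "group (xor_tuple_group d k)"
proof (rule groupI)
  fix u assume "u \<in> carrier (xor_tuple_group d k)"
  then show "\<exists>v\<in>carrier (xor_tuple_group d k).
      v \<otimes>\<^bsub>xor_tuple_group d k\<^esub> u = \<one>\<^bsub>xor_tuple_group d k\<^esub>"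
    by (intro bexI[of _ u]) (auto simp: tuples_iff_nth xor_tuple_self)
qed (auto simp: tuples_iff_nth xor_nat_less_two_power list_eq_iff_nth_eq
    xor.assoc)

text \<open>The group has exponent dividing 2. Thus the Cayley condition on \<open>(g, h)\<close> is
  simply that \<open>xor_tuple g h\<close> lies in the connection set.\<close>

lemma inv_xor_tuple_group:
  assumes "u \<in> tuples d (2 ^ k)"
  shows "inv\<^bsub>xor_tuple_group d k\<^esub> u = u"
  using assms
  by (intro group.inv_equality group_xor_tuple_group)
    (auto simp: tuples_iff_nth xor_tuple_self)

text \<open>Excluding the zero tuple affects only the all-ones alternative, which is the identity
  when \<open>d = 0\<close> or \<open>k = 0\<close>; it mirrors the condition that \<open>u\<close>
  differs from its complement.\<close>

definition ham_compl_set :: "nat \<Rightarrow> nat \<Rightarrow> nat list set" where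
  "ham_compl_set d k =
     {s \<in> tuples d (2 ^ k). s \<noteq> replicate d 0 \<and>
        ((\<exists>!i. i < d \<and> s ! i \<noteq> 0) \<or> s = replicate d (2 ^ k - 1))}"

lemma xor_tuple_eq_iff:
  assumes "length u = d" "length v = d" "length w = d"
  shows "xor_tuple u v = w \<longleftrightarrow> v = xor_tuple u w"
  using assms by (auto simp: list_eq_iff_nth_eq xor_eq_iff_nat)

lemma xor_tuple_all_ones:
  assumes "u \<in> tuples d (2 ^ k)"
  shows "xor_tuple u (replicate d (2 ^ k - 1)) = tuple_compl (2 ^ k) u"
  using assms xor_two_power_minus_1_nat
  by (simp add: list_eq_iff_nth_eq tuples_iff_nth tuple_compl_def)

text \<open>Both graphs live on the same tuples, so they are equal and not merely isomorphic. The
  length \<open>d\<close> and the word size \<open>k\<close> vary independently.\<close>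

lemma extended_hamming_graph_eq_cayley_graph:
  "extended_hamming_graph d (2 ^ k) = cayley_graph (xor_tuple_group d k) (ham_compl_set d k)"
proof -
  have "(u, v) \<in> parcs (extended_hamming_graph d (2 ^ k)) \<longleftrightarrow> xor_tuple u v \<in> ham_compl_set d k"
    if u: "u \<in> tuples d (2 ^ k)" and v: "v \<in> tuples d (2 ^ k)" for u v
  proof -
    have len: "length u = d" "length v = d"
      using u v by (auto simp: tuples_def)
    have "xor_tuple u v \<in> tuples d (2 ^ k)"
      using u v by (auto simp: tuples_iff_nth xor_nat_less_two_power)
    moreover have "xor_tuple u v = replicate d 0 \<longleftrightarrow> u = v"
      using len by (auto simp: list_eq_iff_nth_eq xor_eq_0_iff_nat)
    moreover have "(\<exists>!i. i < d \<and> xor_tuple u v ! i \<noteq> 0) \<longleftrightarrow> (\<exists>!i. i < d \<and> u ! i \<noteq> v ! i)"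
      using len by (intro arg_cong[where f = Ex1] ext)
        (simp add: xor_eq_0_iff_nat del: neq0_conv cong: conj_cong)
    moreover have "xor_tuple u v = replicate d (2 ^ k - 1) \<longleftrightarrow> v = tuple_compl (2 ^ k) u"
      using len u by (subst xor_tuple_eq_iff[of _ d]) (simp_all only: xor_tuple_all_ones length_replicate)
    moreover have "(u, v) \<in> parcs (extended_hamming_graph d (2 ^ k)) \<longleftrightarrow>
        (\<exists>!i. i < d \<and> u ! i \<noteq> v ! i) \<or> (v = tuple_compl (2 ^ k) u \<and> u \<noteq> v)"
      using u v unfolding extended_hamming_graph_def hamming_graph_def by simp blast
    \<comment> \<open>This makes the nonzero condition of \<open>ham_compl_set\<close> automatic on
      Hamming arcs, so that it constrains complement arcs alone.\<close>
    moreover have "u \<noteq> v" if "\<exists>!i. i < d \<and> u ! i \<noteq> v ! i"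
      using that by auto
    ultimately show ?thesis
      unfolding ham_compl_set_def mem_Collect_eq by argo
  qed
  \<comment> \<open>The equivalence above speaks only of pairs of vertices; this excludes any other
    arcs.\<close>
  moreover have "parcs (extended_hamming_graph d (2 ^ k)) \<subseteq> tuples d (2 ^ k) \<times> tuples d (2 ^ k)"
    by (auto simp: extended_hamming_graph_def hamming_graph_def tuple_compl_in_tuples)
  ultimately have "parcs (extended_hamming_graph d (2 ^ k)) =
      {(u, v). u \<in> tuples d (2 ^ k) \<and> v \<in> tuples d (2 ^ k) \<and> xor_tuple u v \<in> ham_compl_set d k}"
    by auto
  also have "\<dots> = parcs (cayley_graph (xor_tuple_group d k) (ham_compl_set d k))"
    by (simp add: cayley_graph_def inv_xor_tuple_group cong: conj_cong)
  finally show ?thesis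
    by (simp add: extended_hamming_graph_def cayley_graph_def)
qed

theorem theorem4p2:
  fixes n :: nat
  assumes "n \<ge> 1"
  shows "\<exists>(G :: nat list monoid) S.
    group G \<and> finite (carrier G) \<and>
    S \<subseteq> carrier G - {\<one>\<^bsub>G\<^esub>} \<and> S = set_inv\<^bsub>G\<^esub> S \<and>
    digraph_iso (with_proj (extended_hamming_graph n (2 ^ n))) (with_proj (cayley_graph G S))"
proof (rule exI[of _ "xor_tuple_group n n"], rule exI[of _ "ham_compl_set n n"], intro conjI)
  let ?G = "xor_tuple_group n n" and ?S = "ham_compl_set n n"
  show "group ?G"
    by (rule group_xor_tuple_group)
  show "finite (carrier ?G)"
    by (simp add: finite_tuples)
  show "?S \<subseteq> carrier ?G - {\<one>\<^bsub>?G\<^esub>}"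
    by (auto simp: ham_compl_set_def)
  \<comment> \<open>Inversion fixes \<open>?S\<close> pointwise, hence \<open>?S\<close> is
    inverse-closed.\<close>
  have inv: "inv\<^bsub>?G\<^esub> s = s" if "s \<in> ?S" for s
    using that by (simp add: ham_compl_set_def inv_xor_tuple_group)
  show "?S = set_inv\<^bsub>?G\<^esub> ?S"
    by (simp add: SET_INV_def inv)
  let ?E = "extended_hamming_graph n (2 ^ n)"
  \<comment> \<open>As the two graphs coincide, reflexivity of \<open>digraph_iso\<close> suffices,
    witnessed by the identity map.\<close>
  have "\<exists>f. bij_betw f (pverts ?E) (pverts ?E) \<and>
      (\<forall>u\<in>pverts ?E. \<forall>v\<in>pverts ?E. (u, v) \<in> parcs ?E \<longleftrightarrow> (f u, f v) \<in> parcs ?E)"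
    by (rule exI[of _ id]) simp
  then have "digraph_iso (with_proj ?E) (with_proj ?E)"
    by (simp only: digraph_iso_with_proj_iff pair_graph_extended_hamming_graph)
  then show "digraph_iso (with_proj ?E) (with_proj (cayley_graph ?G ?S))"
    by (simp only: extended_hamming_graph_eq_cayley_graph)
qed

end
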